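(* There is an absolute constant $c>0$ such that for all integers $r\ge 1$, $d\ge 2$ and $n\ge r$ there is a dataset $D$ of $n$ $d$-dimensional tuples such that every set $S\subseteq D$ of size $r$ satisfies $\nabla_{\mathbb{L}}(S)\ge c\,n/r$ (i.e., $\nabla_{\mathbb{L}}(S)$ is $\Omega(n/r)$).
   Context: A dataset $D$ is a set of $n$ distinct tuples in $[0,1]^d$ such that for each attribute $i$ some tuple $t\in D$ has $t[i]=1$. $\mathbb{L}=\{u\in\mathbb{R}^d: u[i]\ge 0\ \forall i\}$ is the set of (linear) utility vectors. The utility of $t$ for $u$ is $w(u,t)=\sum_{i=1}^d u[i]t[i]$. The rank $\nabla_u(t)$ of $t\in D$ for $u$ is one plus the number of tuples $t'\in D$ with $w(u,t')>w(u,t)$. For nonempty $S\subseteq D$, $\nabla_u(S)=\min_{t\in S}\nabla_u(t)$ and $\nabla_{\mathbb{L}}(S)=\max_{u\in\mathbb{L}}\nabla_u(S)$. *)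

theory Defs
  imports Jordan_Normal_Form.Matrix
begin

definition is_dataset :: "nat \<Rightarrow> nat \<Rightarrow> real vec set \<Rightarrow> bool" where
  "is_dataset n d D \<longleftrightarrow>
     finite D \<and> card D = n \<and> D \<subseteq> carrier_vec d \<and>
     (\<forall>t\<in>D. \<forall>i<d. 0 \<le> t $ i \<and> t $ i \<le> 1) \<and>
     (\<forall>i<d. \<exists>t\<in>D. t $ i = 1)"

definition linear_utilities :: "nat \<Rightarrow> real vec set" where
  "linear_utilities d = {u \<in> carrier_vec d. \<forall>i<d. 0 \<le> u $ i}"

definition utility :: "real vec \<Rightarrow> real vec \<Rightarrow> real" where
  "utility u t = u \<bullet> t"

definition tuple_rank :: "real vec set \<Rightarrow> real vec \<Rightarrow> real vec \<Rightarrow> nat" where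
  "tuple_rank D u t = 1 + card {t' \<in> D. utility u t' > utility u t}"

definition set_rank :: "real vec set \<Rightarrow> real vec \<Rightarrow> real vec set \<Rightarrow> nat" where
  "set_rank D u S = Min (tuple_rank D u ` S)"

definition max_rank :: "nat \<Rightarrow> real vec set \<Rightarrow> real vec set \<Rightarrow> nat" where
  "max_rank d D S = Max ((\<lambda>u. set_rank D u S) ` linear_utilities d)"

text \<open>
  The set of utility vectors is infinite, but only finitely many ranks occur, so the
  maximum in \<^const>\<open>max_rank\<close> is a genuine one.
\<close>

lemma set_rank_le:
  assumes "finite D" "S \<subseteq> D" "S \<noteq> {}"
  shows "set_rank D u S \<le> Suc (card D)"
proof -
  have "finite S" using assms finite_subset by blast
  then have "set_rank D u S \<in> tuple_rank D u ` S"
    unfolding set_rank_def using assms(3) by (intro Min_in) auto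
  then obtain t where "set_rank D u S = tuple_rank D u t" by blast
  also have "\<dots> \<le> Suc (card D)"
    unfolding tuple_rank_def using assms(1) by (auto intro: card_mono)
  finally show ?thesis .
qed

lemma finite_set_ranks:
  assumes "finite D" "S \<subseteq> D" "S \<noteq> {}"
  shows "finite ((\<lambda>u. set_rank D u S) ` linear_utilities d)"
  by (rule finite_subset[of _ "{..Suc (card D)}"]) (use set_rank_le[OF assms] in auto)

lemma linear_utilities_nonempty: "linear_utilities d \<noteq> {}"
proof -
  have "0\<^sub>v d \<in> linear_utilities d" by (simp add: linear_utilities_def)
  then show ?thesis by blast
qed

end

theory Submission imports Defs begin

text \<open>
  Place the tuples on the parabola \<open>y = 1 - x\<^sup>2\<close> at equally spaced abscissae. The utility vector
  normal to the parabola at the \<open>k\<close>-th tuple ranks all tuples by their distance from the \<open>k\<close>-th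
  one. With \<open>g = n div (2 * r)\<close>, the \<open>g\<close>-neighbourhoods of \<open>r\<close> tuples cannot cover all
  \<open>n\<close> indices, and at least \<open>g\<close> tuples lie closer to an uncovered index than the \<open>r\<close> given ones.
\<close>

text \<open>
  The index is shifted by one, and the parabola slightly raised to compensate, so that the case
  of a single tuple is not degenerate. The remaining coordinates are constant and thus play no
  role in any utility that vanishes on them.
\<close>

definition parabola_point :: "nat \<Rightarrow> nat \<Rightarrow> nat \<Rightarrow> real vec" where
  "parabola_point d n k = vec d (\<lambda>i.
     if i = 0 then real (k + 1) / real n
     else if i = 1 then 1 + (1 / real n)\<^sup>2 - (real (k + 1) / real n)\<^sup>2
     else 1)"

text \<open>The gradient \<open>(2 * x, 1)\<close> of \<open>x\<^sup>2 + y\<close> at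
  \<open>x = (k + 1) / n\<close>, multiplied by \<open>n\<close> to clear the denominator; a
  positive factor does not affect ranks.\<close>

definition parabola_normal :: "nat \<Rightarrow> nat \<Rightarrow> nat \<Rightarrow> real vec" where
  "parabola_normal d n k = vec d (\<lambda>i.
     if i = 0 then 2 * real (k + 1) else if i = 1 then real n else 0)"

lemma inj_on_parabola_point:
  assumes "d > 0" "n > 0"
  shows "inj_on (parabola_point d n) A"
proof (rule inj_onI)
  fix j k assume "parabola_point d n j = parabola_point d n k"
  then have "parabola_point d n j $ 0 = parabola_point d n k $ 0" by simp
  then show "j = k" using assms by (simp add: parabola_point_def)
qed

lemma is_dataset_parabola:
  assumes "d > 0" "n > 0"
  shows "is_dataset n d (parabola_point d n ` {..<n})"
  unfolding is_dataset_def
proof (intro conjI ballI allI impI)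
  show "card (parabola_point d n ` {..<n}) = n"
    by (simp add: card_image inj_on_parabola_point assms)
  show "parabola_point d n ` {..<n} \<subseteq> carrier_vec d"
    by (auto simp: parabola_point_def)
next
  fix t i assume "t \<in> parabola_point d n ` {..<n}" and i: "i < d"
  then obtain k where k: "k < n" "t = parabola_point d n k" by auto
  have "(1 / real n)\<^sup>2 \<le> (real (k + 1) / real n)\<^sup>2"
    by (intro power_mono divide_right_mono) auto
  moreover have "(real (k + 1) / real n)\<^sup>2 \<le> 1"
    using k by (intro power_le_one) auto
  moreover have "(0::real) \<le> (1 / real n)\<^sup>2" by simp
  ultimately have "0 \<le> 1 + (1 / real n)\<^sup>2 - (real (k + 1) / real n)\<^sup>2"
    "1 + (1 / real n)\<^sup>2 - (real (k + 1) / real n)\<^sup>2 \<le> 1" by linarith+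
  then show "0 \<le> t $ i" "t $ i \<le> 1"
    using k i by (auto simp: parabola_point_def)
next
  fix i assume i: "i < d"
  show "\<exists>t\<in>parabola_point d n ` {..<n}. t $ i = 1"
  proof (cases "i = 0")
    case True
    then have "parabola_point d n (n - 1) $ i = 1"
      using i assms by (simp add: parabola_point_def)
    then show ?thesis using assms by (intro bexI[of _ "parabola_point d n (n - 1)"]) auto
  next
    case False
    \<comment> \<open>For \<open>i = 1\<close> this relies on the raise by
      \<open>(1 / real n)\<^sup>2\<close>, which lifts the first tuple to height exactly 1.\<close>
    then have "parabola_point d n 0 $ i = 1"
      using i by (simp add: parabola_point_def)
    then show ?thesis using assms by (intro bexI[of _ "parabola_point d n 0"]) auto
  qed
qed simp

lemma parabola_normal_in_linear_utilities: "parabola_normal d n k \<in> linear_utilities d"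
  by (auto simp: linear_utilities_def parabola_normal_def)

text \<open>Completing the square gives \<open>2 * (k + 1) * (j + 1) - (j + 1)\<^sup>2 = (k +
  1)\<^sup>2 - (j - k)\<^sup>2\<close>, so \<open>j\<close> enters only through its distance from
  \<open>k\<close>.\<close>

lemma utility_parabola:
  assumes "d \<ge> 2" "n > 0"
  shows "utility (parabola_normal d n k) (parabola_point d n j) =
     real n + (1 + (real (k + 1))\<^sup>2 - (real j - real k)\<^sup>2) / real n"
proof -
  have "utility (parabola_normal d n k) (parabola_point d n j) =
      (\<Sum>i\<in>{0..<d}. parabola_normal d n k $ i * parabola_point d n j $ i)"
    by (simp add: utility_def scalar_prod_def parabola_point_def)
  also have "\<dots> = (\<Sum>i\<in>{0, 1}. parabola_normal d n k $ i * parabola_point d n j $ i)"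
    using assms by (intro sum.mono_neutral_right) (auto simp: parabola_normal_def)
  also have "\<dots> = 2 * real (k + 1) * (real (j + 1) / real n)
      + real n * (1 + (1 / real n)\<^sup>2 - (real (j + 1) / real n)\<^sup>2)"
    using assms by (simp add: parabola_normal_def parabola_point_def)
  also have "\<dots> = real n + (1 + (real (k + 1))\<^sup>2 - (real j - real k)\<^sup>2) / real n"
    using assms by (simp add: field_simps power2_eq_square)
  finally show ?thesis .
qed

lemma utility_parabola_less_iff:
  assumes "d \<ge> 2" "n > 0"
  shows "utility (parabola_normal d n k) (parabola_point d n i)
       < utility (parabola_normal d n k) (parabola_point d n j) \<longleftrightarrow>
     \<bar>int j - int k\<bar> < \<bar>int i - int k\<bar>"
proof -
  have "utility (parabola_normal d n k) (parabola_point d n i)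
       < utility (parabola_normal d n k) (parabola_point d n j) \<longleftrightarrow>
     (real j - real k)\<^sup>2 < (real i - real k)\<^sup>2"
    using assms by (simp add: utility_parabola divide_less_cancel)
  also have "\<dots> \<longleftrightarrow> \<bar>real j - real k\<bar> < \<bar>real i - real k\<bar>"
    by (simp add: abs_le_square_iff flip: linorder_not_le)
  also have "\<dots> \<longleftrightarrow> \<bar>int j - int k\<bar> < \<bar>int i - int k\<bar>" by linarith
  finally show ?thesis .
qed

text \<open>A union bound: each \<open>s\<close> rules out at most \<open>2 * g - 1\<close> indices,
  too few altogether to exhaust \<open>{..<n}\<close>.\<close>

lemma exists_far_index:
  fixes K :: "nat set"
  assumes "finite K" "g > 0" "card K * (2 * g - 1) < n"
  shows "\<exists>k<n. \<forall>s\<in>K. int g \<le> \<bar>int s - int k\<bar>"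
proof (rule ccontr)
  assume "\<not> ?thesis"
  \<comment> \<open>Truncated subtraction cuts the interval off at 0 when \<open>s + 1 < g\<close>;
    this only shortens it, so its length stays at most \<open>2 * g - 1\<close>.\<close>
  then have "{..<n} \<subseteq> (\<Union>s\<in>K. {s + 1 - g..<s + g})" by fastforce
  then have "n \<le> card (\<Union>s\<in>K. {s + 1 - g..<s + g})"
    using card_mono[of "\<Union>s\<in>K. {s + 1 - g..<s + g}" "{..<n}"] assms by simp
  also have "\<dots> \<le> (\<Sum>s\<in>K. card {s + 1 - g..<s + g})"
    by (rule card_UN_le[OF assms(1)])
  also have "\<dots> \<le> card K * (2 * g - 1)"
    using sum_bounded_above[of K "\<lambda>s. card {s + 1 - g..<s + g}" "2 * g - 1"] by simp
  finally show False using assms by simp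
qed

text \<open>At either end of the range only one side of \<open>k\<close> is available, hence the
  bound \<open>g\<close> instead of \<open>2 * g - 1\<close>.\<close>

lemma card_near_indices:
  assumes "2 * g \<le> n" "k < n"
  shows "g \<le> card {j. j < n \<and> \<bar>int j - int k\<bar> < int g}"
proof -
  \<comment> \<open>The block of length \<open>g\<close> starting at \<open>k\<close> is used if it
    fits. Otherwise \<open>k > n - g \<ge> g\<close>, so the block ending at \<open>k\<close>
    fits.\<close>
  define a where "a = (if k + g \<le> n then k else k + 1 - g)"
  have "{a..<a + g} \<subseteq> {j. j < n \<and> \<bar>int j - int k\<bar> < int g}"
    using assms by (auto simp: a_def split: if_splits)
  then have "card {a..<a + g} \<le> card {j. j < n \<and> \<bar>int j - int k\<bar> < int g}"
    by (intro card_mono) auto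
  then show ?thesis by simp
qed

lemma set_rank_le_max_rank:
  assumes "finite D" "S \<subseteq> D" "S \<noteq> {}" "u \<in> linear_utilities d"
  shows "set_rank D u S \<le> max_rank d D S"
  unfolding max_rank_def using assms finite_set_ranks by (intro Max_ge) auto

text \<open>The inequality is strict because a rank is one more than the number of better tuples;
  this later absorbs the rounding in \<open>div\<close>.\<close>

lemma max_rank_parabola_ge:
  assumes "d \<ge> 2" "n > 0" "K \<subseteq> {..<n}" "K \<noteq> {}"
  shows "n div (2 * card K) < max_rank d (parabola_point d n ` {..<n}) (parabola_point d n ` K)"
proof -
  define g where "g = n div (2 * card K)"
  define D where "D = parabola_point d n ` {..<n}"
  have K: "finite K" "card K > 0"
    using assms finite_subset by (auto simp: card_gt_0_iff)
  have "g * (2 * card K) \<le> n" unfolding g_def by simp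
  then have gn: "card K * (2 * g) \<le> n" by (simp add: mult_ac)
  moreover have "2 * g \<le> card K * (2 * g)" using K by simp
  ultimately have g2: "2 * g \<le> n" by linarith
  have "\<exists>k<n. \<forall>s\<in>K. int g \<le> \<bar>int s - int k\<bar>"
  \<comment> \<open>If \<open>g = 0\<close>, any index will do. Otherwise passing from
    \<open>2 * g\<close> to \<open>2 * g - 1\<close> yields the strict bound required by
    \<open>exists_far_index\<close>.\<close>
  proof (cases "g = 0")
    case False
    then have "card K * (2 * g - 1) < card K * (2 * g)" using K by simp
    also note gn
    finally show ?thesis using K False by (intro exists_far_index) auto
  qed (use assms in auto)
  then obtain k where k: "k < n" "\<And>s. s \<in> K \<Longrightarrow> int g \<le> \<bar>int s - int k\<bar>" by blast
  let ?u = "parabola_normal d n k"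
  have rank: "g < tuple_rank D ?u (parabola_point d n s)" if "s \<in> K" for s
  proof -
    let ?J = "{j. j < n \<and> \<bar>int j - int k\<bar> < int g}"
    \<comment> \<open>Indices in \<open>?J\<close> are at distance less than \<open>g\<close> from
      \<open>k\<close>, and \<open>s\<close> is at distance at least \<open>g\<close>.\<close>
    have "parabola_point d n ` ?J \<subseteq>
        {t' \<in> D. utility ?u (parabola_point d n s) < utility ?u t'}"
      using k(2)[OF that] assms by (auto simp: D_def utility_parabola_less_iff)
    then have "card (parabola_point d n ` ?J) \<le>
        card {t' \<in> D. utility ?u (parabola_point d n s) < utility ?u t'}"
      by (intro card_mono) (auto simp: D_def)
    moreover have "card (parabola_point d n ` ?J) = card ?J"
      using assms by (intro card_image inj_on_parabola_point) auto
    ultimately show ?thesis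
      using card_near_indices[OF g2 k(1)] by (simp add: tuple_rank_def)
  qed
  have "g < set_rank D ?u (parabola_point d n ` K)"
    unfolding set_rank_def using rank K assms by (subst Min_gr_iff) auto
  also have "\<dots> \<le> max_rank d D (parabola_point d n ` K)"
    using assms parabola_normal_in_linear_utilities
    by (intro set_rank_le_max_rank) (auto simp: D_def)
  finally show ?thesis by (simp add: g_def D_def)
qed

theorem theorem2:
  "\<exists>c::real. c > 0 \<and>
     (\<forall>(r::nat) (d::nat) (n::nat). r \<ge> 1 \<longrightarrow> d \<ge> 2 \<longrightarrow> n \<ge> r \<longrightarrow>
        (\<exists>D. is_dataset n d D \<and>
           (\<forall>S. S \<subseteq> D \<longrightarrow> card S = r \<longrightarrow>
              real (max_rank d D S) \<ge> c * real n / real r)))"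
\<comment> \<open>The constant comes from the divisor \<open>2 * r\<close>:
  \<open>n div (2 * r) < m\<close> is equivalent to \<open>n < m * (2 * r)\<close>, so the floor
  costs nothing.\<close>
proof (rule exI[of _ "1/2"], intro conjI allI impI)
  fix r d n :: nat assume r: "r \<ge> 1" and d: "d \<ge> 2" and n: "n \<ge> r"
  define D where "D = parabola_point d n ` {..<n}"
  have "real (max_rank d D S) \<ge> 1/2 * real n / real r" if "S \<subseteq> D" "card S = r" for S
  proof -
    obtain K where K: "K \<subseteq> {..<n}" "S = parabola_point d n ` K"
      using \<open>S \<subseteq> D\<close> unfolding D_def by (auto simp: subset_image_iff)
    have "card K = r"
      using that K r n d inj_on_parabola_point[of d n K] by (simp add: card_image)
    then have "n div (2 * r) < max_rank d D S"
      using max_rank_parabola_ge[of d n K] K r n d unfolding D_def by force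
    then have "n < max_rank d D S * (2 * r)"
      using r by (simp add: div_less_iff_less_mult)
    then have "real n < real (max_rank d D S * (2 * r))"
      by (rule iffD2[OF of_nat_less_iff])
    then show ?thesis using r by (simp add: field_simps)
  qed
  moreover have "is_dataset n d D"
    unfolding D_def using r d n by (intro is_dataset_parabola) auto
  ultimately show "\<exists>D. is_dataset n d D \<and> (\<forall>S. S \<subseteq> D \<longrightarrow> card S = r \<longrightarrow>
      real (max_rank d D S) \<ge> 1/2 * real n / real r)" by blast
qed simp

end
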